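(* Let $k$ be a positive integer whose prime decomposition contains a prime $p \equiv 3 \pmod 4$ raised to an odd power. Then an optimal $(2k(k-1) + 2,k,1)$-optical orthogonal code does not exist.
   Context: A $(v,k,1)$-optical orthogonal code ($(v,k,1)$-OOC) of size $n$ is a set $\mathcal{C}$ of $n$ $(0,1)$-vectors of length $v$, each of Hamming weight $k$, such that (with subscripts reduced modulo $v$): for every $\mathbf{x}=(x_0,\dots,x_{v-1}) \in \mathcal{C}$ and every integer $0<\tau<v$, $\sum_{i=0}^{v-1} x_i x_{i+\tau} \le 1$; and for all $\mathbf{x}\ne\mathbf{y}$ in $\mathcal{C}$ and every integer $0\le\tau<v$, $\sum_{i=0}^{v-1} x_i y_{i+\tau} \le 1$. The size of a $(v,k,1)$-OOC is always at most $\left\lfloor \frac{v-1}{k(k-1)} \right\rfloor$; it is called optimal if its size equals $\left\lfloor \frac{v-1}{k(k-1)} \right\rfloor$. *)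

theory Defs
  imports "HOL-Number_Theory.Number_Theory"
begin

definition hamming_weight :: "nat list \<Rightarrow> nat" where
  "hamming_weight x = card {i. i < length x \<and> x ! i \<noteq> 0}"

definition correlation :: "nat \<Rightarrow> nat list \<Rightarrow> nat list \<Rightarrow> nat \<Rightarrow> nat" where
  "correlation v x y \<tau> = (\<Sum>i = 0..<v. x ! i * y ! ((i + \<tau>) mod v))"

text \<open>The (0,1)-vectors of length \<open>v\<close> are lists of natural numbers of length \<open>v\<close> with entries
  in \<open>{0, 1}\<close>; hence every code is a finite set, and its size is its cardinality.\<close>

definition optical_orthogonal_code :: "nat \<Rightarrow> nat \<Rightarrow> nat list set \<Rightarrow> bool" where
  "optical_orthogonal_code v k C \<longleftrightarrow>
     (\<forall>x\<in>C. length x = v \<and> set x \<subseteq> {0, 1} \<and> hamming_weight x = k) \<and>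
     (\<forall>x\<in>C. \<forall>\<tau>. 0 < \<tau> \<and> \<tau> < v \<longrightarrow> correlation v x x \<tau> \<le> 1) \<and>
     (\<forall>x\<in>C. \<forall>y\<in>C. x \<noteq> y \<longrightarrow> (\<forall>\<tau>. 0 \<le> \<tau> \<and> \<tau> < v \<longrightarrow> correlation v x y \<tau> \<le> 1))"

definition optimal_optical_orthogonal_code :: "nat \<Rightarrow> nat \<Rightarrow> nat list set \<Rightarrow> bool" where
  "optimal_optical_orthogonal_code v k C \<longleftrightarrow>
     optical_orthogonal_code v k C \<and>
     int (card C) = \<lfloor>(real v - 1) / (real k * (real k - 1))\<rfloor>"

end

theory Submission
  imports Defs
begin

text \<open>
  Put \<open>m = k (k - 1) + 1\<close>, an odd number, so that the length of the code is \<open>2 m\<close>. An optimal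
  code has two codewords, since \<open>k \<ge> 3\<close>. The correlation conditions imply that the \<open>2 k (k - 1) = 2 m - 2\<close>
  differences modulo \<open>2 m\<close> between distinct positions inside the support of a codeword are
  pairwise distinct (lemma \<open>difference_injective\<close>). None of them is \<open>0\<close>, and none is the
  involution \<open>m\<close>, because \<open>b - a = m\<close> would give \<open>a - b = m\<close> as well. This leaves \<open>m - 1\<close> odd
  and \<open>m - 1\<close> even values, as \<open>m\<close> is odd; so exactly \<open>m - 1 = k (k - 1)\<close> of the differences are
  odd.

  On the other hand, if the support of a codeword \<open>x\<close> has \<open>e\<^sub>x\<close> even and \<open>o\<^sub>x\<close> odd elements, it
  contributes \<open>2 e\<^sub>x o\<^sub>x\<close> odd differences. Hence
  \<open>(\<Sum>x. (e\<^sub>x - o\<^sub>x)\<^sup>2) = (\<Sum>x. (e\<^sub>x + o\<^sub>x)\<^sup>2 - 4 e\<^sub>x o\<^sub>x) = 2 k\<^sup>2 - 2 k (k - 1) = 2 k\<close>,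
  so \<open>2 k\<close> is a sum of two squares. (This is the evaluation of the quadratic character of the
  cyclic group of order \<open>2 m\<close> on the corresponding group ring identity.) A prime
  \<open>p \<equiv> 3 (mod 4)\<close> occurs in a nonzero sum of two squares to an even power, and as \<open>p\<close> is odd, it
  occurs to the same power in \<open>k\<close>.
\<close>

section \<open>Primes congruent to 3 modulo 4 and sums of two squares\<close>

lemma sum_dvd_sum_odd_powers:
  fixes x y :: "'a :: comm_ring_1"
  assumes "odd n"
  shows "x + y dvd x ^ n + y ^ n"
proof -
  have "x - (- y) dvd x ^ n - (- y) ^ n"
    by (simp add: power_diff_sumr2)
  with assms show ?thesis by simp
qed

text \<open>If \<open>p\<close> did not divide \<open>a\<close>, it would not divide \<open>b\<close> either, and \<open>a\<^sup>2 \<equiv> - b\<^sup>2\<close> raised to the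
  odd power \<open>(p - 1) / 2\<close> would give \<open>1 \<equiv> - 1\<close> by Fermat's theorem.\<close>

lemma prime_3_mod_4_dvd_sum_of_squares:
  fixes a b p :: nat
  assumes p: "prime p" "[p = 3] (mod 4)" and dvd: "p dvd a\<^sup>2 + b\<^sup>2"
  shows "p dvd a"
proof (rule ccontr)
  assume na: "\<not> p dvd a"
  have nb: "\<not> p dvd b"
  proof
    assume "p dvd b"
    hence "p dvd b\<^sup>2" by (simp add: power2_eq_square)
    with dvd have "p dvd a\<^sup>2" using dvd_add_left_iff by blast
    with p(1) na show False using prime_dvd_power by blast
  qed
  have p4: "p mod 4 = 3" using p(2) by (simp add: cong_def)
  define n where "n = (p - 1) div 2"
  have n: "2 * n = p - 1" "odd n" unfolding n_def using p4 by presburger+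
  have "int (a\<^sup>2) + int (b\<^sup>2) dvd int (a\<^sup>2) ^ n + int (b\<^sup>2) ^ n"
    using n(2) by (rule sum_dvd_sum_odd_powers)
  moreover have "int (a\<^sup>2) ^ n + int (b\<^sup>2) ^ n = int (a ^ (p - 1) + b ^ (p - 1))"
    unfolding n(1)[symmetric] by (simp add: power_mult)
  ultimately have "int (a\<^sup>2 + b\<^sup>2) dvd int (a ^ (p - 1) + b ^ (p - 1))" by simp
  hence "p dvd a ^ (p - 1) + b ^ (p - 1)"
    using dvd dvd_trans int_dvd_int_iff by blast
  moreover have "[a ^ (p - 1) + b ^ (p - 1) = 1 + 1] (mod p)"
    using fermat_theorem[OF p(1) na] fermat_theorem[OF p(1) nb] by (rule cong_add)
  ultimately have "p dvd 1 + 1" by (simp only: cong_dvd_iff)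
  hence "p \<le> 1 + 1" by (rule dvd_imp_le) simp
  moreover have "p \<noteq> 0" using p(1) by auto
  ultimately have "p = 1 \<or> p = 2" by auto
  with p4 show False by auto
qed

lemma even_multiplicity_sum_of_squares:
  fixes a b p :: nat
  assumes p: "prime p" "[p = 3] (mod 4)" and "a\<^sup>2 + b\<^sup>2 \<noteq> 0"
  shows "even (multiplicity p (a\<^sup>2 + b\<^sup>2))"
  using assms(3)
proof (induction "a + b" arbitrary: a b rule: less_induct)
  case less
  show ?case
  proof (cases "p dvd a\<^sup>2 + b\<^sup>2")
    case False
    thus ?thesis by (simp add: not_dvd_imp_multiplicity_0)
  next
    case True
    have "p dvd a" using prime_3_mod_4_dvd_sum_of_squares[OF p True] .
    then obtain c where c: "a = p * c" by blast
    have "p dvd b"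
      using prime_3_mod_4_dvd_sum_of_squares[OF p, of b a] True by (simp add: add.commute)
    then obtain d where d: "b = p * d" by blast
    have eq: "a\<^sup>2 + b\<^sup>2 = p\<^sup>2 * (c\<^sup>2 + d\<^sup>2)"
      by (simp add: c d power_mult_distrib algebra_simps)
    have nz: "c\<^sup>2 + d\<^sup>2 \<noteq> 0" using less.prems eq by auto
    have "1 < p" using p(1) by (rule prime_gt_1_nat)
    moreover have "0 < c + d" using nz by (cases "c = 0") auto
    ultimately have "1 * (c + d) < p * (c + d)" by (rule mult_strict_right_mono)
    hence "c + d < a + b" by (simp add: c d algebra_simps)
    hence "even (multiplicity p (c\<^sup>2 + d\<^sup>2))" using less.hyps nz by blast
    moreover have "multiplicity p (a\<^sup>2 + b\<^sup>2) = 2 + multiplicity p (c\<^sup>2 + d\<^sup>2)"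
      unfolding eq using p(1) nz
      by (subst prime_elem_multiplicity_mult_distrib) (auto simp: multiplicity_same_power)
    ultimately show ?thesis by simp
  qed
qed

section \<open>Differences of positions in the supports of codewords\<close>

text \<open>The positions of the nonzero entries of a vector.\<close>

definition support :: "nat list \<Rightarrow> nat set" where
  "support x = {i. i < length x \<and> x ! i \<noteq> 0}"

lemma finite_support [simp]: "finite (support x)"
  by (simp add: support_def)

lemma correlation_le_one_unique:
  assumes "length x = v" "correlation v x y \<tau> \<le> 1"
    and i: "i \<in> support x" "(i + \<tau>) mod v \<in> support y"
    and j: "j \<in> support x" "(j + \<tau>) mod v \<in> support y"
  shows "i = j"
proof (rule ccontr)
  assume "i \<noteq> j"
  let ?f = "\<lambda>i. x ! i * y ! ((i + \<tau>) mod v)"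
  have "?f i \<ge> 1" "?f j \<ge> 1"
    using i j by (auto simp: support_def Suc_le_eq)
  hence "1 + 1 \<le> ?f i + ?f j" by (rule add_mono)
  also have "\<dots> = sum ?f {i, j}" using \<open>i \<noteq> j\<close> by simp
  also have "\<dots> \<le> sum ?f {0..<v}"
    using assms(1) i(1) j(1) by (intro sum_mono2) (auto simp: support_def)
  finally show False using assms(2) by (simp add: correlation_def)
qed

lemma shift_mod_eq:
  fixes a b v \<tau> :: nat
  assumes "b < v" "int \<tau> = (int b - int a) mod int v"
  shows "(a + \<tau>) mod v = b"
proof -
  have "int ((a + \<tau>) mod v) = (int a + (int b - int a) mod int v) mod int v"
    by (simp add: zmod_int assms(2))
  also have "\<dots> = int b" using assms(1) by (simp add: mod_simps)
  finally show ?thesis by simp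
qed

text \<open>Both correlation conditions together: a difference determines the codeword and the two
  positions from which it arises.\<close>

lemma difference_injective:
  assumes ooc: "optical_orthogonal_code v k C" and xy: "x \<in> C" "y \<in> C"
    and a: "a \<in> support x" "a' \<in> support x" "a \<noteq> a'"
    and b: "b \<in> support y" "b' \<in> support y"
    and eq: "(int a' - int a) mod int v = (int b' - int b) mod int v"
  shows "x = y \<and> a = b \<and> a' = b'"
proof -
  have len: "length x = v" "length y = v"
    using ooc xy by (auto simp: optical_orthogonal_code_def)
  have lt: "a < v" "a' < v" "b < v" "b' < v"
    using a b len by (auto simp: support_def)
  hence v: "v > 0" by simp
  have "x = y"
  proof (rule ccontr)
    assume "x \<noteq> y"
    \<comment> \<open>The shift that takes \<open>a\<close> to \<open>b\<close> also takes \<open>a'\<close> to \<open>b'\<close>.\<close>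
    define \<tau> where "\<tau> = nat ((int b - int a) mod int v)"
    have \<tau>: "int \<tau> = (int b - int a) mod int v" using v by (simp add: \<tau>_def)
    have "(int b - int a) mod int v = (int b' - int a') mod int v"
      using eq unfolding mod_eq_dvd_iff by (simp add: algebra_simps dvd_diff_commute)
    hence sh: "(a + \<tau>) mod v = b" "(a' + \<tau>) mod v = b'"
      using \<tau> lt by (auto intro!: shift_mod_eq)
    have "\<tau> < v" using \<tau> v by (metis of_nat_less_iff pos_mod_bound of_nat_0_less_iff)
    hence "correlation v x y \<tau> \<le> 1"
      using ooc xy \<open>x \<noteq> y\<close> by (auto simp: optical_orthogonal_code_def)
    hence "a = a'"
      using correlation_le_one_unique[OF len(1), of y \<tau> a a'] a(1,2) b sh by simp
    with a(3) show False by contradiction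
  qed
  \<comment> \<open>The shift that takes \<open>a\<close> to \<open>a'\<close> also takes \<open>b\<close> to \<open>b'\<close>.\<close>
  define \<tau> where "\<tau> = nat ((int a' - int a) mod int v)"
  have \<tau>: "int \<tau> = (int a' - int a) mod int v" using v by (simp add: \<tau>_def)
  have sh: "(a + \<tau>) mod v = a'" "(b + \<tau>) mod v = b'"
    using \<tau> eq lt by (auto intro!: shift_mod_eq)
  have "\<tau> \<noteq> 0" using sh(1) lt a(3) by (cases "\<tau> = 0") auto
  moreover have "\<tau> < v" using \<tau> v by (metis of_nat_less_iff pos_mod_bound of_nat_0_less_iff)
  ultimately have "correlation v x x \<tau> \<le> 1"
    using ooc xy by (auto simp: optical_orthogonal_code_def)
  hence "a = b"
    using correlation_le_one_unique[OF len(1), of x \<tau> a b] a(1,2) b sh \<open>x = y\<close> by simp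
  with sh \<open>x = y\<close> show ?thesis by simp
qed

section \<open>Counting odd differences\<close>

lemma card_pairs_odd_sum:
  assumes "finite S"
  shows "card {(a, b). a \<in> S \<and> b \<in> S \<and> odd (a + b)} =
         2 * (card {a \<in> S. even a} * card {a \<in> S. odd (a :: nat)})"
proof -
  let ?E = "{a \<in> S. even a}" and ?O = "{a \<in> S. odd a}"
  have "{(a, b). a \<in> S \<and> b \<in> S \<and> odd (a + b)} = ?E \<times> ?O \<union> ?O \<times> ?E" by auto
  moreover have "card (?E \<times> ?O \<union> ?O \<times> ?E) = card (?E \<times> ?O) + card (?O \<times> ?E)"
    using assms by (intro card_Un_disjoint) auto
  ultimately show ?thesis by (simp add: card_cartesian_product)
qed

lemma card_pairs_distinct:
  assumes "finite S"
  shows "card {(a, b). a \<in> S \<and> b \<in> S \<and> a \<noteq> b} = card S * (card S - 1)"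
proof -
  have "{(a, b). a \<in> S \<and> b \<in> S \<and> a \<noteq> b} = (SIGMA a:S. S - {a})" by auto
  thus ?thesis using assms by simp
qed

lemma card_even_residues:
  "card {d. 0 < d \<and> d < 2 * int m \<and> even d} = m - 1"
proof -
  have "{d. 0 < d \<and> d < 2 * int m \<and> even d} = (\<lambda>j. 2 * j) ` {1..<int m}"
    by (auto elim!: evenE)
  moreover have "inj_on (\<lambda>j :: int. 2 * j) {1..<int m}" by (auto intro: inj_onI)
  ultimately show ?thesis by (simp add: card_image)
qed

lemma card_odd_residues_except_half:
  assumes "odd m"
  shows "card {d. 0 < d \<and> d < 2 * int m \<and> odd d \<and> d \<noteq> int m} = m - 1"
proof -
  have "{d. 0 < d \<and> d < 2 * int m \<and> odd d} = (\<lambda>j. 2 * j + 1) ` {0..<int m}"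
    by (auto elim!: oddE)
  moreover have "inj_on (\<lambda>j :: int. 2 * j + 1) {0..<int m}" by (auto intro: inj_onI)
  ultimately have "card {d. 0 < d \<and> d < 2 * int m \<and> odd d} = m" by (simp add: card_image)
  moreover have "{d. 0 < d \<and> d < 2 * int m \<and> odd d \<and> d \<noteq> int m} =
      {d. 0 < d \<and> d < 2 * int m \<and> odd d} - {int m}" by auto
  moreover have "m > 0" using assms by (auto intro: Nat.gr0I)
  ultimately show ?thesis using assms by (simp add: card_Diff_singleton)
qed

text \<open>The hypothesis on the length leaves room for \<open>k (k - 1)\<close> odd and \<open>k (k - 1)\<close> even
  differences, and two codewords fill it.\<close>

lemma sum_even_odd_products:
  assumes ooc: "optical_orthogonal_code (2 * k * (k - 1) + 2) k C" and C: "card C = 2"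
  shows "(\<Sum>x\<in>C. 2 * (card {a \<in> support x. even a} * card {a \<in> support x. odd a})) = k * (k - 1)"
proof -
  define m where "m = k * (k - 1) + 1"
  define v where "v = 2 * m"
  have "2 * k * (k - 1) + 2 = v" by (simp add: v_def m_def)
  with ooc have ooc: "optical_orthogonal_code v k C" by simp
  have "odd m" by (cases k) (auto simp: m_def)
  hence "m > 0" by (auto intro: Nat.gr0I)
  have finC: "finite C" using C by (simp add: card_ge_0_finite)
  have lt: "a < v" if "x \<in> C" "a \<in> support x" for x a
    using ooc that by (auto simp: optical_orthogonal_code_def support_def)
  have wt: "card (support x) = k" if "x \<in> C" for x
    using ooc that by (auto simp: optical_orthogonal_code_def support_def hamming_weight_def)
  define P where "P = (SIGMA x:C. {(a, b). a \<in> support x \<and> b \<in> support x \<and> a \<noteq> b})"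
  define Podd where "Podd = (SIGMA x:C. {(a, b). a \<in> support x \<and> b \<in> support x \<and> odd (a + b)})"
  define f where "f = (\<lambda>(x :: nat list, a :: nat, b :: nat). (int b - int a) mod int v)"
  have finpairs: "finite {(a, b). a \<in> support x \<and> b \<in> support x \<and> Q a b}" for x Q
    by (rule finite_subset[of _ "support x \<times> support x"]) auto
  have finP: "finite P" unfolding P_def using finC finpairs by (intro finite_SigmaI)
  have sub: "Podd \<subseteq> P" by (auto simp: P_def Podd_def)
  have cardP: "card P = 2 * (k * (k - 1))"
    unfolding P_def using finC finpairs by (simp add: card_pairs_distinct wt C)
  have cardPodd: "card Podd =
      (\<Sum>x\<in>C. 2 * (card {a \<in> support x. even a} * card {a \<in> support x. odd a}))"
    unfolding Podd_def using finC finpairs by (simp add: card_pairs_odd_sum del: even_add odd_add)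

  have inj: "inj_on f P"
  proof (rule inj_onI)
    fix s t assume st: "s \<in> P" "t \<in> P" "f s = f t"
    obtain x a a' y b b' where "s = (x, a, a')" "t = (y, b, b')" by (metis prod_cases3)
    thus "s = t"
      using st difference_injective[OF ooc, of x y a a' b b'] by (auto simp: P_def f_def)
  qed
  have pos: "0 < f s \<and> f s < 2 * int m" if s: "s \<in> P" for s
  proof -
    obtain x a b where [simp]: "s = (x, a, b)" by (metis prod_cases3)
    have ab: "a < v" "b < v" "a \<noteq> b" using s lt by (auto simp: P_def)
    have "f s \<noteq> 0"
    proof
      assume "f s = 0"
      hence "(a + 0) mod v = b" using ab by (intro shift_mod_eq) (auto simp: f_def)
      with ab show False by simp
    qed
    moreover have "0 \<le> f s" "f s < int v" using \<open>m > 0\<close> by (auto simp: f_def v_def)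
    ultimately show ?thesis by (simp add: v_def)
  qed
  have nhalf: "f s \<noteq> int m" if s: "s \<in> P" for s
  proof
    assume half: "f s = int m"
    obtain x a b where [simp]: "s = (x, a, b)" by (metis prod_cases3)
    have "(int a - int b) mod int v = (- ((int b - int a) mod int v)) mod int v"
      by (simp add: mod_minus_eq)
    also have "\<dots> = (- int m) mod int v" using half by (simp add: f_def)
    also have "\<dots> = (- int m + int v) mod int v" by simp
    also have "\<dots> = int m" using \<open>m > 0\<close> by (simp add: v_def)
    finally have "f (x, b, a) = f s" using half by (simp add: f_def)
    moreover have "(x, b, a) \<in> P" using s by (auto simp: P_def)
    ultimately have "(x, b, a) = s" using inj s by (auto dest: inj_onD)
    with s show False by (auto simp: P_def)
  qed
  have parity: "odd (f s) \<longleftrightarrow> s \<in> Podd" if s: "s \<in> P" for s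
  proof -
    obtain x a b where [simp]: "s = (x, a, b)" by (metis prod_cases3)
    have "even ((int b - int a) mod int v) \<longleftrightarrow> even (int b - int a)"
      by (rule dvd_mod_iff) (simp add: v_def)
    thus ?thesis using s by (auto simp: f_def P_def Podd_def)
  qed

  have "card Podd = card (f ` Podd)"
    using inj sub by (metis card_image inj_on_subset)
  also have "\<dots> \<le> card {d. 0 < d \<and> d < 2 * int m \<and> odd d \<and> d \<noteq> int m}"
  proof (rule card_mono)
    show "finite {d. 0 < d \<and> d < 2 * int m \<and> odd d \<and> d \<noteq> int m}"
      by (rule finite_subset[of _ "{0..2 * int m}"]) auto
    show "f ` Podd \<subseteq> {d. 0 < d \<and> d < 2 * int m \<and> odd d \<and> d \<noteq> int m}"
    proof (rule image_subsetI)
      fix s assume "s \<in> Podd"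
      moreover from this sub have "s \<in> P" by blast
      ultimately show "f s \<in> {d. 0 < d \<and> d < 2 * int m \<and> odd d \<and> d \<noteq> int m}"
        using pos[of s] nhalf[of s] parity[of s] by simp
    qed
  qed
  also have "\<dots> = k * (k - 1)"
    unfolding card_odd_residues_except_half[OF \<open>odd m\<close>] by (simp add: m_def)
  finally have "card Podd \<le> k * (k - 1)" .
  moreover have "card (P - Podd) = card (f ` (P - Podd))"
    using inj by (metis card_image inj_on_subset Diff_subset)
  moreover have "\<dots> \<le> card {d. 0 < d \<and> d < 2 * int m \<and> even d}"
  proof (rule card_mono)
    show "finite {d. 0 < d \<and> d < 2 * int m \<and> even d}"
      by (rule finite_subset[of _ "{0..2 * int m}"]) auto
    show "f ` (P - Podd) \<subseteq> {d. 0 < d \<and> d < 2 * int m \<and> even d}"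
    proof (rule image_subsetI)
      fix s assume "s \<in> P - Podd"
      thus "f s \<in> {d. 0 < d \<and> d < 2 * int m \<and> even d}"
        using pos[of s] parity[of s] by simp
    qed
  qed
  moreover have "\<dots> = k * (k - 1)" by (simp only: card_even_residues) (simp add: m_def)
  moreover have "card P = card Podd + card (P - Podd)"
    using finP sub by (metis card_Diff_subset card_mono finite_subset le_add_diff_inverse)
  ultimately have "card Podd = k * (k - 1)" using cardP by linarith
  thus ?thesis using cardPodd by simp
qed

lemma twice_weight_sum_of_squares:
  assumes ooc: "optical_orthogonal_code (2 * k * (k - 1) + 2) k C" and C: "card C = 2"
  shows "\<exists>a b :: nat. a\<^sup>2 + b\<^sup>2 = 2 * k"
proof -
  define e where "e = (\<lambda>x. card {a \<in> support x. even a})"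
  define u where "u = (\<lambda>x. card {a \<in> support x. odd a})"
  have eu: "e x + u x = k" if "x \<in> C" for x
  proof -
    have "e x + u x = card ({a \<in> support x. even a} \<union> {a \<in> support x. odd a})"
      unfolding e_def u_def by (rule card_Un_disjoint[symmetric]) auto
    also have "{a \<in> support x. even a} \<union> {a \<in> support x. odd a} = support x" by auto
    also have "card (support x) = k"
      using ooc that by (auto simp: optical_orthogonal_code_def support_def hamming_weight_def)
    finally show ?thesis .
  qed
  obtain x y where xy: "C = {x, y}" "x \<noteq> y" using C by (auto simp: card_2_iff)
  have "2 * (e x * u x) + 2 * (e y * u y) = k * (k - 1)"
    using sum_even_odd_products[OF ooc C] xy by (simp add: e_def u_def)
  hence "int (2 * (e x * u x) + 2 * (e y * u y)) = int (k * (k - 1))" by (rule arg_cong)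
  hence sum: "2 * (int (e x) * int (u x)) + 2 * (int (e y) * int (u y)) = int k * (int k - 1)"
    by (cases k) (auto simp: algebra_simps)
  have sq: "(int (e z) - int (u z))\<^sup>2 = (int k)\<^sup>2 - 4 * (int (e z) * int (u z))" if "z \<in> C" for z
  proof -
    have "int k = int (e z) + int (u z)" using eu[OF that] by simp
    thus ?thesis by (simp add: power2_eq_square algebra_simps)
  qed
  have "(int (e x) - int (u x))\<^sup>2 + (int (e y) - int (u y))\<^sup>2 =
      2 * (int k)\<^sup>2 - 2 * (2 * (int (e x) * int (u x)) + 2 * (int (e y) * int (u y)))"
    using sq[of x] sq[of y] xy by simp
  also have "\<dots> = 2 * int k"
    unfolding sum by (simp add: power2_eq_square algebra_simps)
  finally have "int ((nat \<bar>int (e x) - int (u x)\<bar>)\<^sup>2 + (nat \<bar>int (e y) - int (u y)\<bar>)\<^sup>2) = int (2 * k)"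
    by simp
  thus ?thesis by (metis of_nat_eq_iff)
qed

section \<open>Nonexistence\<close>

theorem corollary4p8:
  fixes k :: nat
  assumes "k > 0"
    and "\<exists>p. prime p \<and> [p = 3] (mod 4) \<and> odd (multiplicity p k)"
  shows "\<not> (\<exists>C. optimal_optical_orthogonal_code (2 * k * (k - 1) + 2) k C)"
proof
  assume "\<exists>C. optimal_optical_orthogonal_code (2 * k * (k - 1) + 2) k C"
  then obtain C where ooc: "optical_orthogonal_code (2 * k * (k - 1) + 2) k C"
    and size: "int (card C) =
      \<lfloor>(real (2 * k * (k - 1) + 2) - 1) / (real k * (real k - 1))\<rfloor>"
    by (auto simp: optimal_optical_orthogonal_code_def)
  obtain p where p: "prime p" "[p = 3] (mod 4)" "odd (multiplicity p k)"
    using assms(2) by blast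
  have "p \<noteq> 2" using p(2) by (auto simp: cong_def)
  have "p \<ge> 2" using p(1) by (rule prime_ge_2_nat)
  have "p dvd k" using p(3) by (metis even_zero not_dvd_imp_multiplicity_0)
  hence "k \<ge> 3" using assms(1) \<open>p \<noteq> 2\<close> \<open>p \<ge> 2\<close> by (auto dest: dvd_imp_le)

  define n where "n = real k * (real k - 1)"
  have "1 * 1 < n" unfolding n_def using \<open>k \<ge> 3\<close> by (intro mult_strict_mono) auto
  have "real (2 * k * (k - 1) + 2) - 1 = 2 * n + 1"
    using assms(1) by (simp add: n_def of_nat_diff)
  moreover have "\<lfloor>(2 * n + 1) / n\<rfloor> = 2"
    using \<open>1 * 1 < n\<close> by (intro floor_unique) (auto simp: field_simps)
  ultimately have "int (card C) = 2" using size by (simp only: n_def)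
  hence "card C = 2" by simp

  then obtain a b :: nat where ab: "a\<^sup>2 + b\<^sup>2 = 2 * k"
    using twice_weight_sum_of_squares[OF ooc] by blast
  hence "even (multiplicity p (2 * k))"
    using even_multiplicity_sum_of_squares[OF p(1,2), of a b] assms(1) by simp
  moreover have "multiplicity p (2 * k) = multiplicity p 2 + multiplicity p k"
    using p(1) assms(1) by (intro prime_elem_multiplicity_mult_distrib) auto
  moreover have "multiplicity p 2 = 0"
    using p(1) \<open>p \<noteq> 2\<close> by (intro not_dvd_imp_multiplicity_0) (auto dest: primes_dvd_imp_eq[OF _ two_is_prime_nat])
  ultimately show False using p(3) by simp
qed

end
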